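(* Let $m \geq 2$. The strategy $\textsc{AdSch}$ for weighted search on $m$ rays is $\phi(m-1)$-competitive, i.e. $c(\textsc{AdSch},I) \leq \phi(m-1)\cdot opt(I)$ for every $I \in \mathcal{I}_m$, and its competitive ratio $\rho(\textsc{AdSch})=\sup_{I\in\mathcal{I}_m} c(\textsc{AdSch},I)/opt(I)$ equals $\phi(m-1)$. Moreover, $\phi(m-1)$ is the optimal competitive ratio for weighted search: every search strategy $\Sigma$ has $\rho(\Sigma) \geq \phi(m-1)$.
   Context: Weighted search on $m$ rays: a star consists of $m$ infinite rays $0,\dots,m-1$ with common origin $O$. An instance is $I=(W,(d_i,w_i)_{0\le i\le m-1})$ with $W\ge 0$, weights $w_i \ge 0$, distances $d_i \in [1,\infty]$ ($d_i=\infty$ meaning no target), and $\sum_i w_i \ge W$; the set of all such instances is $\mathcal{I}_m$. On ray $i$ a target of weight $w_i$ is hidden at distance $d_i$ from $O$. A searcher starts at $O$ with no knowledge of the instance. A (deterministic) search strategy chooses, each time the searcher is at $O$, a ray $r$ and a depth $l_r$ (possibly depending on everything observed so far); the searcher walks along $r$ up to depth $l_r$ and returns to $O$, except that if it meets the target of $r$ it immediately returns to $O$ and never searches $r$ again. The cost $c(\Sigma,I)$ is the total distance traversed until the first moment the discovered targets have aggregate weight at least $W$. For $S\subseteq\{0,\dots,m-1\}$ let $w_S=\sum_{i\in S}w_i$ and $d_S = 2\sum_{i\in S} d_i - \max_{i\in S} d_i$; then $opt(I)=\min\{d_S : w_S \ge W\}$. The competitive ratio of $\Sigma$ is $\rho(\Sigma)=\sup_{I\in\mathcal{I}_m}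 c(\Sigma,I)/opt(I)$. For $x>0$ let $b_x = 1+1/x$ and $\phi(x) = 1+2(1+x)(1+1/x)^x = 1 + 2 b_x^{x+1}/(b_x-1)$. For $1\le f\le m$ write $b_{m,f}=b_{m-f}=1+\frac{1}{m-f}$. Strategy $\textsc{AdSub}$ (cyclic adaptive search): maintain $f=1$ (one plus the number of targets found), a current ray index $r=0$, and $D=1$; the remaining (not yet emptied) rays are labelled $0,\dots,m-f$ in their original relative order. Repeatedly: explore ray $r$ up to distance $D\cdot b_{m,f}$ or until a target is found (when $f=m$, only one ray remains and it is explored until its target is found). If no target is found, set $r \leftarrow r+1 \pmod{m-f+1}$ and $D\leftarrow D\cdot b_{m,f}$. If a target is found, set $f\leftarrow f+1$ (leaving $D$ unchanged), remove ray $r$, relabel the remaining rays $0,\dots,m-f$ preserving their relative order, and set $r\leftarrow r \pmod{m-f+1}$. Strategy $\textsc{AdSch}$ for weighted search executes $\textsc{AdSub}$ (ignoring weights) and stops as soon as the discovered targets have aggregate weight at least $W$. *)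

theory Defs
  imports Complex_Main "HOL-Library.Extended_Nonnegative_Real"
begin

(* Rays are 0..<m. A ray without a target has distance \<infinity>;
   values of the fields at indices \<ge> m are irrelevant. *)
record search_instance =
  required :: real
  dist_of :: "nat \<Rightarrow> ennreal"
  weight_of :: "nat \<Rightarrow> real"

definition search_instances :: "nat \<Rightarrow> search_instance set" where
  "search_instances m =
     {I. 0 \<le> required I \<and> (\<forall>i<m. 0 \<le> weight_of I i) \<and> (\<forall>i<m. 1 \<le> dist_of I i) \<and>
         required I \<le> (\<Sum>i<m. weight_of I i)}"

definition total_weight :: "search_instance \<Rightarrow> nat set \<Rightarrow> real" where
  "total_weight I S = (\<Sum>i\<in>S. weight_of I i)"

(* SUP is the maximum for finite nonempty S and 0 for S = {}. If some distance is \<infinity>,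
   the difference is \<infinity> - \<infinity>, which is \<infinity> in ennreal. *)
definition tour_length :: "search_instance \<Rightarrow> nat set \<Rightarrow> ennreal" where
  "tour_length I S = 2 * (\<Sum>i\<in>S. dist_of I i) - (SUP i\<in>S. dist_of I i)"

definition opt :: "nat \<Rightarrow> search_instance \<Rightarrow> ennreal" where
  "opt m I = Min {tour_length I S | S. S \<subseteq> {..<m} \<and> required I \<le> total_weight I S}"


(* What the searcher learns from one walk: None if no target was met, Some (d, w) if a target
   of weight w was met at distance d. Histories list the observations most recent first; the
   rays and depths chosen so far need not be recorded, since a deterministic strategy can
   reconstruct them. The strategy sees neither W nor anything else about the instance. *)
type_synonym observation = "(ennreal \<times> real) option"

type_synonym strategy = "observation list \<Rightarrow> nat \<times> ennreal"

fun emptied :: "strategy \<Rightarrow> observation list \<Rightarrow> nat set" where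
  "emptied \<sigma> [] = {}"
| "emptied \<sigma> (None # h) = emptied \<sigma> h"
| "emptied \<sigma> (Some _ # h) = insert (fst (\<sigma> h)) (emptied \<sigma> h)"

(* Once all rays are emptied the search is over (the total weight is at least W), so nothing
   is required of the strategy there. *)
definition search_strategy :: "nat \<Rightarrow> strategy \<Rightarrow> bool" where
  "search_strategy m \<sigma> \<longleftrightarrow>
     (\<forall>h. {..<m} - emptied \<sigma> h \<noteq> {} \<longrightarrow> fst (\<sigma> h) \<in> {..<m} - emptied \<sigma> h)"

definition observe :: "search_instance \<Rightarrow> nat \<Rightarrow> ennreal \<Rightarrow> observation" where
  "observe I r l =
     (if dist_of I r \<le> l \<and> dist_of I r \<noteq> \<infinity> then Some (dist_of I r, weight_of I r) else None)"

(* The history after n walks. It is continued beyond the end of the search; the cost below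
   only uses the part up to the end. *)
primrec history :: "strategy \<Rightarrow> search_instance \<Rightarrow> nat \<Rightarrow> observation list" where
  "history \<sigma> I 0 = []"
| "history \<sigma> I (Suc n) =
     (let h = history \<sigma> I n; (r, l) = \<sigma> h in observe I r l # h)"

definition satisfied :: "strategy \<Rightarrow> search_instance \<Rightarrow> nat \<Rightarrow> bool" where
  "satisfied \<sigma> I n \<longleftrightarrow> required I \<le> total_weight I (emptied \<sigma> (history \<sigma> I n))"

(* The distance from O at which the n-th walk (counting from 0) turns back. *)
definition reach :: "strategy \<Rightarrow> search_instance \<Rightarrow> nat \<Rightarrow> ennreal" where
  "reach \<sigma> I n = (let (r, l) = \<sigma> (history \<sigma> I n) in min (dist_of I r) l)"

(* Every walk but the last is traversed in both directions; the last one ends at the target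
   that brings the aggregate weight to W. The cost is \<infinity> if W is never reached, even if the
   walks have finite total length. *)
definition cost :: "strategy \<Rightarrow> search_instance \<Rightarrow> ennreal" where
  "cost \<sigma> I =
     (if \<exists>n. satisfied \<sigma> I n then
        (case (LEAST n. satisfied \<sigma> I n) of
           0 \<Rightarrow> 0
         | Suc n \<Rightarrow> (\<Sum>k<n. 2 * reach \<sigma> I k) + reach \<sigma> I n)
      else \<infinity>)"

(* In ennreal, 0 / 0 = 0 and \<infinity> / \<infinity> = 0, so the degenerate instances with opt = 0 (W = 0) or
   opt = \<infinity> (W unreachable), where the quotient is undefined, do not affect the supremum. *)
definition competitive_ratio :: "nat \<Rightarrow> strategy \<Rightarrow> ennreal" where
  "competitive_ratio m \<sigma> = (SUP I\<in>search_instances m. cost \<sigma> I / opt m I)"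


definition base :: "real \<Rightarrow> real" where
  "base x = 1 + 1 / x"

definition phi :: "real \<Rightarrow> real" where
  "phi x = 1 + 2 * (1 + x) * (1 + 1 / x) powr x"

(* The state (f, r, D, rs): rs lists the remaining rays in their original order, so that the
   ray with current label j is rs ! j. *)
fun adsub_state :: "nat \<Rightarrow> observation list \<Rightarrow> nat \<times> nat \<times> real \<times> nat list" where
  "adsub_state m [] = (1, 0, 1, [0..<m])"
| "adsub_state m (None # h) =
     (let (f, r, D, rs) = adsub_state m h
      in (f, (r + 1) mod (m - f + 1), D * base (real m - real f), rs))"
| "adsub_state m (Some _ # h) =
     (let (f, r, D, rs) = adsub_state m h; f' = f + 1
      in (f', r mod (m - f' + 1), D, take r rs @ drop (Suc r) rs))"

definition AdSub :: "nat \<Rightarrow> strategy" where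
  "AdSub m h =
     (let (f, r, D, rs) = adsub_state m h
      in (rs ! r, if f = m then \<infinity> else ennreal (D * base (real m - real f))))"

(* Stopping once the aggregate weight reaches W is part of the definition of cost. *)
definition AdSch :: "nat \<Rightarrow> strategy" where
  "AdSch m = AdSub m"

lemma adsub_state_invariant:
  assumes "adsub_state m h = (f, r, D, rs)" "m \<ge> 1"
  shows "distinct rs \<and> set rs = {..<m} - emptied (AdSub m) h \<and>
         (f \<le> m \<longrightarrow> length rs = m - f + 1 \<and> r < length rs) \<and> (f > m \<longrightarrow> rs = [])"
  using assms
proof (induction m h arbitrary: f r D rs rule: adsub_state.induct)
  case (1 m)
  then show ?case by auto
next
  case (2 m h)
  obtain f0 r0 D0 rs0 where s: "adsub_state m h = (f0, r0, D0, rs0)"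
    by (cases "adsub_state m h") auto
  have "f = f0" "r = (r0 + 1) mod (m - f0 + 1)" "rs = rs0" using 2(2) s by auto
  then show ?case using 2(1)[OF s 2(3)] by simp
next
  case (3 m v h)
  obtain f0 r0 D0 rs0 where s: "adsub_state m h = (f0, r0, D0, rs0)"
    by (cases "adsub_state m h") auto
  have eqs: "f = f0 + 1" "r = r0 mod (m - f + 1)" "rs = take r0 rs0 @ drop (Suc r0) rs0"
    using 3(2) s by (auto simp: Let_def)
  note inv = 3(1)[OF s 3(3)]
  show ?case
  proof (cases "f0 \<le> m")
    case True
    with inv have len: "length rs0 = m - f0 + 1" "r0 < length rs0" by auto
    have sp: "rs0 = take r0 rs0 @ rs0 ! r0 # drop (Suc r0) rs0"
      using len(2) by (rule id_take_nth_drop)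
    have fst: "fst (AdSub m h) = rs0 ! r0" using s by (simp add: AdSub_def)
    have d: "distinct (take r0 rs0 @ rs0 ! r0 # drop (Suc r0) rs0)"
      by (subst sp[symmetric]) (use inv in blast)
    have st: "set rs0 = insert (rs0 ! r0) (set rs)"
      unfolding eqs(3) by (subst sp) simp
    have ni: "rs0 ! r0 \<notin> set rs" using d eqs(3) by auto
    have "distinct rs" using d eqs(3) by auto
    moreover have "set rs = {..<m} - emptied (AdSub m) (Some v # h)"
      using inv st fst ni by simp blast
    moreover have lr: "length rs = m - f0" using len eqs(3) by simp
    have "f \<le> m \<longrightarrow> length rs = m - f + 1 \<and> r < length rs"
    proof
      assume "f \<le> m"
      then have "m - f0 = m - f + 1" using eqs(1) by linarith
      moreover have "r < m - f + 1" unfolding eqs(2) by (rule mod_less_divisor) simp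
      ultimately show "length rs = m - f + 1 \<and> r < length rs" using lr by presburger
    qed
    moreover have "f > m \<longrightarrow> rs = []"
    proof
      assume "f > m"
      then have "length rs = 0" using lr eqs(1) by linarith
      then show "rs = []" by blast
    qed
    ultimately show ?thesis by blast
  next
    case False
    then have "rs0 = []" "\<not> f \<le> m" using inv eqs(1) by simp_all
    moreover from this have "rs = []" using eqs(3) by simp
    moreover have "{..<m} - emptied (AdSub m) h = {}"
      using inv \<open>rs0 = []\<close> by (metis empty_set)
    then have "{..<m} - emptied (AdSub m) (Some v # h) = {}" by auto
    ultimately show ?thesis by simp
  qed
qed

lemma AdSch_search_strategy:
  assumes "m \<ge> 1"
  shows "search_strategy m (AdSch m)"
  unfolding search_strategy_def AdSch_def
proof (intro allI impI)
  fix h assume ne: "{..<m} - emptied (AdSub m) h \<noteq> {}"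
  obtain f r D rs where s: "adsub_state m h = (f, r, D, rs)"
    by (cases "adsub_state m h") auto
  note inv = adsub_state_invariant[OF s assms]
  have st: "set rs = {..<m} - emptied (AdSub m) h"
    and le: "f \<le> m \<Longrightarrow> r < length rs" and gt: "f > m \<Longrightarrow> rs = []"
    using inv by blast+
  have "rs \<noteq> []" using ne unfolding st[symmetric] by simp
  then have "f \<le> m" using gt not_le by blast
  then have "rs ! r \<in> set rs" by (intro nth_mem le)
  moreover have "fst (AdSub m h) = rs ! r" by (simp add: AdSub_def s)
  ultimately show "fst (AdSub m h) \<in> {..<m} - emptied (AdSub m) h"
    unfolding st[symmetric] by simp
qed

end

theory Submission
  imports Defs
begin

text \<open>Put \<open>M = m b\<^sup>m\<^sup>-\<^sup>1\<close> with \<open>b = m / (m - 1)\<close>, so that \<open>\<phi>(m - 1) = 1 + 2 M\<close>.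

  Lower bound: only instances with a single target are needed. Let \<open>P\<close> be the total depth of the
  walks made so far and \<open>a\<^sub>i \<ge> 1\<close> the depth up to which ray \<open>i\<close> has been explored. A ratio
  \<open>1 + 2 C\<close> forces \<open>P \<le> C a\<^sub>i\<close> for all \<open>i\<close> at all times, so the potential \<open>(\<Prod>i. a\<^sub>i) / P\<^sup>m\<close> is at least
  \<open>C\<^sup>-\<^sup>m\<close>. A walk of depth \<open>l\<close> that extends \<open>a\<^sub>r\<close> multiplies it by
  \<open>(l / a\<^sub>r) (P / (P + l))\<^sup>m \<le> C l P\<^sup>m\<^sup>-\<^sup>1 / (P + l)\<^sup>m \<le> C / M\<close>, and this happens infinitely often. Hence
  \<open>C \<ge> M\<close>.

  Upper bound: as long as the search is unfinished, an optimal set contains a target that has not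
  been found, so it suffices to compare the cost with the distance of any such target. The
  total depth of all walks that precede the next visit of a ray, if nothing is found until then, is
  at most \<open>M\<close> times the distance of the target on that ray. Finding a target preserves this, although
  the expansion factor grows: the walk that found it counts as the first walk of the old geometric
  schedule, and each later term of the new schedule is dominated by the next term of the old one.\<close>

section \<open>The lower bound\<close>

lemma phi_nat:
  assumes "m \<ge> 2"
  shows "phi (real m - 1) = 1 + 2 * (real m * base (real m - 1) ^ (m - 1))"
proof -
  have "(1 + 1 / (real m - 1)) powr (real m - 1) = (1 + 1 / (real m - 1)) ^ (m - 1)"
    using powr_realpow[of "1 + 1 / (real m - 1)" "m - 1"] assms
    by (simp add: of_nat_diff field_simps add_pos_nonneg)
  then show ?thesis by (simp add: phi_def base_def)
qed

lemma weighted_am_gm_nat: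
  fixes l P :: real
  assumes "n \<ge> 1" "l \<ge> 0" "P > 0"
  shows "l * (P / real n) ^ n \<le> ((P + l) / (real n + 1)) ^ Suc n"
proof -
  define t s where "t = P / real n" and "s = (P + l) / (real n + 1)"
  have t: "t > 0" using assms by (simp add: t_def)
  have s: "s \<ge> 0" using assms by (simp add: s_def)
  have l: "l = (real n + 1) * s - real n * t" using assms by (simp add: s_def t_def)
  have "1 + real (Suc n) * (s / t - 1) \<le> (1 + (s / t - 1)) ^ Suc n"
    by (rule Bernoulli_inequality) (use s t in simp)
  then have "t ^ Suc n * (1 + real (Suc n) * (s / t - 1)) \<le> t ^ Suc n * (s / t) ^ Suc n"
    using t by (intro mult_left_mono) auto
  also have "\<dots> = s ^ Suc n" using t by (simp only: power_mult_distrib[symmetric]) simp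
  also have "t ^ Suc n * (1 + real (Suc n) * (s / t - 1)) = t ^ n * l"
    using t by (simp add: l field_simps)
  finally show ?thesis by (simp add: t_def s_def mult.commute)
qed

primrec frontier :: "(nat \<Rightarrow> nat) \<Rightarrow> (nat \<Rightarrow> real) \<Rightarrow> nat \<Rightarrow> nat \<Rightarrow> real" where
  "frontier r l i 0 = 1"
| "frontier r l i (Suc k) = (if r k = i then max (frontier r l i k) (l k) else frontier r l i k)"

lemma frontier_ge_1: "1 \<le> frontier r l i k"
  by (induction k) auto

lemma le_frontier: "j < k \<Longrightarrow> r j = i \<Longrightarrow> l j \<le> frontier r l i k"
  by (induction k) (auto simp: less_Suc_eq max_def)

lemma ray_search_lower_bound:
  fixes l :: "nat \<Rightarrow> real" and r :: "nat \<Rightarrow> nat" and C :: real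
  assumes m: "m \<ge> 2" and l: "\<And>k. 0 \<le> l k"
    and cover: "\<And>i d. i < m \<Longrightarrow> 1 \<le> d \<Longrightarrow> \<exists>n. r n = i \<and> d \<le> l n \<and> (\<Sum>k<n. l k) \<le> C * d"
  shows "real m * base (real m - 1) ^ (m - 1) \<le> C"
proof (rule ccontr)
  define n where "n = m - 1"
  have n: "n \<ge> 1" "m = Suc n" using m by (auto simp: n_def)
  define P where "P = (\<lambda>k. \<Sum>j<k. l j)"
  define a where "a = frontier r l"
  define \<Phi> where "\<Phi> = (\<lambda>k. (\<Prod>i<m. a i k) / P k ^ m)"
  define \<delta> where "\<delta> = C * real n ^ n / real m ^ m"
  assume "\<not> real m * base (real m - 1) ^ (m - 1) \<le> C"
  then have "C < real m * (real m / real n) ^ n"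
    using n by (simp add: base_def field_simps)
  then have "C < real m ^ m / real n ^ n" using n(2) by (simp add: power_divide)
  then have "C * real n ^ n < real m ^ m" using n(1) by (simp add: pos_less_divide_eq)
  then have d1: "\<delta> < 1" using n(2) by (simp add: \<delta>_def del: power_Suc of_nat_Suc)
  have a1: "1 \<le> a i k" for i k by (simp add: a_def frontier_ge_1)
  have Pmono: "P j \<le> P k" if "j \<le> k" for j k
    unfolding P_def using that l by (intro sum_mono2) auto
  have late: "\<exists>n\<ge>k. r n = i \<and> d \<le> l n \<and> P n \<le> C * d" if i: "i < m" and d: "a i k < d" for i k d
  proof -
    obtain n where n: "r n = i" "d \<le> l n" "P n \<le> C * d"
      using cover[OF i, of d] d a1[of i k] unfolding P_def by fastforce
    have "\<not> n < k" using le_frontier[of n k r i l] n d by (auto simp: a_def)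
    then show ?thesis using n by (intro exI[of _ n]) auto
  qed
  have P_less: "P k \<le> C * d" if "i < m" "a i k < d" for i k d
    using late[OF that] Pmono by (meson order_trans)
  obtain K where K: "P K > 0"
  proof -
    obtain n where n: "r n = 0" "1 \<le> l n" using cover[of 0 1] m by auto
    have "P (Suc n) = P n + l n" by (simp add: P_def)
    moreover have "P 0 \<le> P n" by (rule Pmono) simp
    ultimately show ?thesis using that[of "Suc n"] n by (simp add: P_def)
  qed
  have Ppos: "P k > 0" if "k \<ge> K" for k using K Pmono[OF that] by linarith
  have C: "C > 0"
  proof -
    have "0 < C * (a 0 K + 1)" using P_less[of 0 K "a 0 K + 1"] K m by simp
    then show ?thesis using a1[of 0 K] by (simp add: zero_less_mult_iff)
  qed
  have P_le: "P k \<le> C * a i k" if "i < m" for i k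
  proof -
    have "P k / C \<le> a i k"
    proof (rule dense_ge)
      fix d assume "a i k < d"
      then show "P k / C \<le> d" using P_less[OF that, of k d] C by (simp add: field_simps)
    qed
    then show ?thesis using C by (simp add: field_simps)
  qed
  have Phi_ge: "(1 / C) ^ m \<le> \<Phi> k" if "k \<ge> K" for k
  proof -
    have "(\<Prod>i<m. P k / C) \<le> (\<Prod>i<m. a i k)"
      using P_le Ppos[OF that] C by (intro prod_mono) (auto simp: field_simps)
    then show ?thesis using Ppos[OF that] C by (simp add: \<Phi>_def field_simps power_divide)
  qed
  have Phi_pos: "\<Phi> k > 0" if "k \<ge> K" for k
    using Phi_ge[OF that] C by (smt (verit) divide_pos_pos zero_less_power)
  have PSuc: "P (Suc k) = P k + l k" for k by (simp add: P_def)
  have extend: "\<Phi> (Suc k) \<le> \<delta> * \<Phi> k" if k: "k \<ge> K" and e: "r k < m" "a (r k) k < l k" for k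
  proof -
    have split: "(\<Prod>i<m. a i k') = a (r k) k' * (\<Prod>i\<in>{..<m} - {r k}. a i k')" for k'
      using e(1) by (simp add: prod.remove)
    have rest: "(\<Prod>i\<in>{..<m} - {r k}. a i (Suc k)) = (\<Prod>i\<in>{..<m} - {r k}. a i k)"
      by (rule prod.cong) (auto simp: a_def)
    have new: "a (r k) (Suc k) = l k" using e(2) by (simp add: a_def)
    define Q where "Q = (\<Prod>i\<in>{..<m} - {r k}. a i k)"
    have Q: "Q \<ge> 0" unfolding Q_def
      by (intro prod_nonneg) (use a1 in \<open>auto intro: order_trans[OF zero_le_one]\<close>)
    define p x where "p = P k" and "x = l k"
    have p: "p > 0" using Ppos[OF k] by (simp add: p_def)
    have x: "x \<ge> 0" using l by (simp add: x_def)
    have am: "x * (p / real n) ^ n \<le> ((p + x) / real m) ^ m"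
      using weighted_am_gm_nat[OF n(1) x p] n(2) by (simp add: add.commute)
    have "x * p ^ n * real m ^ m \<le> real n ^ n * (p + x) ^ m"
      using am n by (simp add: power_divide field_simps del: power_Suc)
    then have "x * p ^ m * real m ^ m \<le> real n ^ n * (p + x) ^ m * p"
      using p n(2) by (simp add: mult.assoc mult.left_commute del: of_nat_Suc)
    also have "\<dots> \<le> real n ^ n * (p + x) ^ m * (C * a (r k) k)"
      using P_le[OF e(1), of k] p x by (intro mult_left_mono) (auto simp: p_def)
    finally have "x / (p + x) ^ m \<le> \<delta> * a (r k) k / p ^ m"
      using p x n by (simp add: \<delta>_def field_simps del: power_Suc of_nat_Suc)
    then have "x / (p + x) ^ m * Q \<le> \<delta> * a (r k) k / p ^ m * Q"
      using Q by (rule mult_right_mono)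
    then show ?thesis
      by (simp add: \<Phi>_def split rest new PSuc p_def[symmetric] x_def[symmetric] Q_def[symmetric])
  qed
  have keep: "\<Phi> (Suc k) \<le> \<Phi> k" if k: "k \<ge> K" for k
  proof (cases "r k < m \<and> a (r k) k < l k")
    case True
    then show ?thesis using extend[OF k] Phi_pos[OF k] d1
      by (smt (verit) mult_le_cancel_right1)
  next
    case False
    have "(\<Prod>i<m. a i (Suc k)) = (\<Prod>i<m. a i k)"
      using False by (intro prod.cong) (auto simp: a_def)
    moreover have "(\<Prod>i<m. a i k) \<ge> 0"
      by (intro prod_nonneg) (use a1 in \<open>auto intro: order_trans[OF zero_le_one]\<close>)
    moreover have "P k ^ m \<le> P (Suc k) ^ m"
      using Ppos[OF k] l by (intro power_mono) (auto simp: PSuc)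
    ultimately show ?thesis
      using Ppos[OF k] unfolding \<Phi>_def by (simp add: frac_le)
  qed
  have decr: "\<Phi> k' \<le> \<Phi> k" if "k \<ge> K" "k \<le> k'" for k k'
    using that(2)
  proof (induction rule: dec_induct)
    case (step j) then show ?case using keep[of j] that(1) by simp
  qed simp
  have again: "\<exists>j\<ge>k. r j < m \<and> a (r j) j < l j" for k
  proof (rule ccontr)
    assume no: "\<not> ?thesis"
    have m0: "0 < m" using m by simp
    obtain n where n: "n \<ge> k" "r n = 0" "a 0 k + 1 \<le> l n"
      using late[of 0 k "a 0 k + 1"] m by auto
    have "a 0 j \<le> a 0 k" if "k \<le> j" for j
      using that
    proof (induction rule: dec_induct)
      case (step j)
      have "\<not> (r j = 0 \<and> a 0 j < l j)" using no step(1) m0 by metis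
      then have "a 0 (Suc j) \<le> a 0 j" by (auto simp: a_def)
      then show ?case using step(3) by linarith
    qed simp
    from this[of n] have "a 0 n < l n" using n by linarith
    then show False using no n m0 by metis
  qed
  have d0: "\<delta> > 0" using C n by (simp add: \<delta>_def)
  have small: "\<exists>k\<ge>K. \<Phi> k \<le> \<delta> ^ N * \<Phi> K" for N
  proof (induction N)
    case (Suc N)
    then obtain k where k: "k \<ge> K" "\<Phi> k \<le> \<delta> ^ N * \<Phi> K" by blast
    obtain j where j: "j \<ge> k" "r j < m" "a (r j) j < l j" using again by blast
    have "\<Phi> (Suc j) \<le> \<delta> * \<Phi> j" using extend j k by simp
    also have "\<dots> \<le> \<delta> * (\<delta> ^ N * \<Phi> K)"
      using decr[of k j] j k d0 by (intro mult_left_mono) auto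
    finally show ?case using j k by (intro exI[of _ "Suc j"]) auto
  qed auto
  obtain N where N: "\<delta> ^ N < (1 / C) ^ m / \<Phi> K"
    using real_arch_pow_inv[of "(1 / C) ^ m / \<Phi> K" \<delta>] d1 C Phi_pos[of K] by auto
  obtain k where "k \<ge> K" "\<Phi> k \<le> \<delta> ^ N * \<Phi> K" using small by blast
  moreover have "\<delta> ^ N * \<Phi> K < (1 / C) ^ m"
    using N Phi_pos[of K] by (simp add: pos_less_divide_eq)
  ultimately show False using Phi_ge[of k] by linarith
qed


definition single_target :: "nat \<Rightarrow> real \<Rightarrow> search_instance" where
  "single_target i d =
     \<lparr>required = 1, dist_of = (\<lambda>j. if j = i then ennreal d else \<infinity>),
      weight_of = (\<lambda>j. if j = i then 1 else 0)\<rparr>"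

lemma single_target_instance: "i < m \<Longrightarrow> 1 \<le> d \<Longrightarrow> single_target i d \<in> search_instances m"
  by (auto simp: search_instances_def single_target_def)

lemma finite_tours: "finite {tour_length I S | S. S \<subseteq> {..<m} \<and> required I \<le> total_weight I S}"
  by (rule finite_subset[of _ "tour_length I ` Pow {..<m}"]) auto

lemma opt_single_target_le:
  assumes "i < m" "1 \<le> d"
  shows "opt m (single_target i d) \<le> ennreal d"
proof -
  let ?I = "single_target i d"
  have "opt m ?I \<le> tour_length ?I {i}"
    unfolding opt_def using assms
    by (intro Min_le finite_tours)
       (auto intro!: exI[of _ "{i}"] simp: total_weight_def single_target_def)
  also have "\<dots> = ennreal d"
    using assms by (simp add: tour_length_def single_target_def mult_2)
  finally show ?thesis .
qed

lemma finite_emptied: "finite (emptied \<sigma> h)"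
  by (induction h rule: emptied.induct) auto

lemma satisfied_single_target:
  "satisfied \<sigma> (single_target i d) n \<longleftrightarrow> i \<in> emptied \<sigma> (history \<sigma> (single_target i d) n)"
  by (simp add: satisfied_def total_weight_def single_target_def sum.delta finite_emptied)

lemma history_single_target:
  "i \<notin> emptied \<sigma> (history \<sigma> (single_target i d) n) \<Longrightarrow>
     history \<sigma> (single_target i d) n = replicate n None"
proof (induction n)
  case (Suc n)
  obtain r l where rl: "\<sigma> (history \<sigma> (single_target i d) n) = (r, l)" by force
  show ?case
  proof (cases "observe (single_target i d) r l")
    case None
    then show ?thesis using Suc rl by simp
  next
    case (Some y)
    then have "r = i" by (auto simp: observe_def single_target_def split: if_splits)
    then show ?thesis using Suc rl Some by simp
  qed
qed simp

lemma cost_single_target: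
  fixes \<sigma> :: strategy
  defines "r \<equiv> \<lambda>n. fst (\<sigma> (replicate n None))" and "l \<equiv> \<lambda>n. snd (\<sigma> (replicate n None))"
  assumes fin: "cost \<sigma> (single_target i d) < \<infinity>"
  obtains n where "r n = i" "ennreal d \<le> l n"
    "cost \<sigma> (single_target i d) = 2 * (\<Sum>k<n. l k) + ennreal d"
proof -
  let ?I = "single_target i d"
  have "\<exists>n. satisfied \<sigma> ?I n" using fin by (auto simp: cost_def split: if_splits)
  define N where "N = (LEAST n. satisfied \<sigma> ?I n)"
  have N: "satisfied \<sigma> ?I N" unfolding N_def by (rule LeastI_ex) fact
  then obtain n where n: "N = Suc n"
    by (cases N) (auto simp: satisfied_single_target)
  have unfound: "i \<notin> emptied \<sigma> (history \<sigma> ?I k)" if "k \<le> n" for k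
    using not_less_Least[of k "satisfied \<sigma> ?I", folded N_def] that n
    by (simp add: satisfied_single_target)
  then have hist: "history \<sigma> ?I k = replicate k None" if "k \<le> n" for k
    using history_single_target that by blast
  have step: "\<sigma> (history \<sigma> ?I k) = (r k, l k)" if "k \<le> n" for k
    using hist[OF that] by (simp add: r_def l_def)
  have found: "r n = i" "ennreal d \<le> l n"
  proof -
    have "i \<in> emptied \<sigma> (observe ?I (r n) (l n) # history \<sigma> ?I n)"
      using N step[of n] by (simp add: n satisfied_single_target)
    then have "observe ?I (r n) (l n) \<noteq> None" using unfound[of n]
      by (cases "observe ?I (r n) (l n)") auto
    then show "r n = i" "ennreal d \<le> l n"
      by (auto simp: observe_def single_target_def split: if_splits)
  qed
  have "reach \<sigma> ?I k = l k" if "k < n" for k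
  proof -
    have "observe ?I (r k) (l k) = None"
    proof -
      have "history \<sigma> ?I (Suc k) = None # replicate k None" using hist[of "Suc k"] that by simp
      then show ?thesis using step[of k] that by simp
    qed
    then show ?thesis using step[of k] that
      by (auto simp: reach_def observe_def min_def single_target_def top_unique split: if_splits)
  qed
  moreover have "reach \<sigma> ?I n = ennreal d"
    using step[of n] found by (simp add: reach_def single_target_def min_def)
  moreover have "cost \<sigma> ?I = (\<Sum>k<n. 2 * reach \<sigma> ?I k) + reach \<sigma> ?I n"
    using \<open>\<exists>n. satisfied \<sigma> ?I n\<close> by (simp add: cost_def N_def[symmetric] n)
  ultimately have "cost \<sigma> ?I = 2 * (\<Sum>k<n. l k) + ennreal d" by (simp add: sum_distrib_left)
  then show ?thesis using that found by blast
qed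

lemma le_times_if_divide_le_ennreal:
  fixes a b c :: ennreal
  assumes "a / b \<le> c" "b < \<infinity>" "c < \<infinity>"
  shows "a \<le> c * b"
proof (cases "b = 0")
  case True
  then show ?thesis using assms by (cases "a = 0") (auto simp: ennreal_divide_zero)
next
  case False
  have "a = a / b * b" using False assms(2)
    by (simp add: ennreal_divide_times ennreal_times_divide mult.commute ennreal_mult_divide_eq)
  also have "\<dots> \<le> c * b" using assms(1) by (rule mult_right_mono) simp
  finally show ?thesis .
qed

lemma divide_le_ennreal_if_le_times:
  fixes a b c :: ennreal
  assumes "a \<le> c * b"
  shows "a / b \<le> c"
proof -
  consider "b = 0" | "b = top" | "b \<noteq> 0" "b \<noteq> top" by blast
  then show ?thesis
  proof cases
    case 3
    have "a / b \<le> c * b / b" by (rule divide_right_mono_ennreal[OF assms])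
    also have "\<dots> = c" using 3 by (simp add: ennreal_mult_divide_eq)
    finally show ?thesis .
  qed (use assms in auto)
qed

lemma competitive_ratio_ge:
  assumes m: "m \<ge> 2"
  shows "ennreal (phi (real m - 1)) \<le> competitive_ratio m \<sigma>"
proof (rule ccontr)
  assume "\<not> ?thesis"
  then have less: "competitive_ratio m \<sigma> < ennreal (phi (real m - 1))" by simp
  define \<rho> where "\<rho> = enn2real (competitive_ratio m \<sigma>)"
  have "competitive_ratio m \<sigma> < \<infinity>" using less
    by (metis ennreal_less_top infinity_ennreal_def order_less_trans)
  then have \<rho>: "competitive_ratio m \<sigma> = ennreal \<rho>" "\<rho> \<ge> 0" by (auto simp: \<rho>_def)
  define r l where "r = (\<lambda>n. fst (\<sigma> (replicate n None)))" and "l = (\<lambda>n. snd (\<sigma> (replicate n None)))"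
  have bound: "\<exists>n. r n = i \<and> ennreal d \<le> l n \<and> 2 * (\<Sum>k<n. l k) + ennreal d \<le> ennreal (\<rho> * d)"
    if i: "i < m" and d: "1 \<le> d" for i d
  proof -
    let ?I = "single_target i d"
    have "cost \<sigma> ?I / opt m ?I \<le> ennreal \<rho>"
      unfolding \<rho>(1)[symmetric] competitive_ratio_def
      by (rule SUP_upper) (rule single_target_instance[OF i d])
    moreover have "opt m ?I < \<infinity>" using opt_single_target_le[OF i d] by (simp add: le_less_trans)
    ultimately have "cost \<sigma> ?I \<le> ennreal \<rho> * opt m ?I"
      by (intro le_times_if_divide_le_ennreal) auto
    also have "\<dots> \<le> ennreal \<rho> * ennreal d"
      by (intro mult_left_mono opt_single_target_le i d) simp
    finally have c: "cost \<sigma> ?I \<le> ennreal (\<rho> * d)" using \<rho>(2) d by (simp add: ennreal_mult)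
    then have "cost \<sigma> ?I < \<infinity>" by (simp add: le_less_trans)
    from cost_single_target[OF this] c show ?thesis unfolding r_def l_def by metis
  qed
  have l_fin: "l k < \<infinity>" for k
  proof (induction k rule: less_induct)
    case (less k)
    show ?case
    proof (rule ccontr)
      assume "\<not> l k < \<infinity>"
      then have lk: "l k = \<infinity>" by (simp add: less_top[symmetric])
      obtain i where i: "i < m" "i \<noteq> r k" using m
        by (metis less_le_trans one_less_numeral_iff semiring_norm(76) zero_less_one
            zero_neq_one order_less_trans)
      define d where "d = 1 + (\<Sum>j<k. enn2real (l j))"
      have "1 \<le> d" by (simp add: d_def sum_nonneg)
      from bound[OF i(1) this] obtain n where n: "r n = i" "ennreal d \<le> l n"
        "2 * (\<Sum>k<n. l k) + ennreal d \<le> ennreal (\<rho> * d)" by blast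
      consider "n < k" | "n = k" | "k < n" by linarith
      then show False
      proof cases
        case 1
        have "enn2real (l n) \<le> (\<Sum>j<k. enn2real (l j))"
          using 1 by (intro member_le_sum) auto
        then have "enn2real (l n) < d" by (simp add: d_def)
        moreover have "l n = ennreal (enn2real (l n))" using less[OF 1] by simp
        ultimately show False using n(2) \<open>1 \<le> d\<close>
          by (metis enn2real_nonneg ennreal_less_iff not_le)
      next
        case 2
        then show False using i n by simp
      next
        case 3
        then have "l k \<le> (\<Sum>k<n. l k)" by (intro member_le_sum) auto
        then have S: "(\<Sum>k<n. l k) = top" using lk by (simp add: top_unique)
        have "2 * (\<Sum>k<n. l k) + ennreal d = \<infinity>" unfolding S by (simp add: ennreal_mult_top)
        then show False using n(3) by (simp add: top_unique)
      qed
    qed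
  qed
  define L where "L = (\<lambda>k. enn2real (l k))"
  have L: "l k = ennreal (L k)" "0 \<le> L k" for k using l_fin[of k] by (auto simp: L_def)
  have "real m * base (real m - 1) ^ (m - 1) \<le> (\<rho> - 1) / 2"
  proof (rule ray_search_lower_bound[OF m, where r = r and l = L])
    fix i d assume "i < m" "(1::real) \<le> d"
    then obtain n where n: "r n = i" "ennreal d \<le> l n"
        "2 * (\<Sum>k<n. l k) + ennreal d \<le> ennreal (\<rho> * d)" using bound by blast
    have s: "(\<Sum>k<n. L k) \<ge> 0" by (simp add: L(2) sum_nonneg)
    have "2 * (\<Sum>k<n. l k) + ennreal d = ennreal (2 * (\<Sum>k<n. L k) + d)"
      using s \<open>1 \<le> d\<close> by (simp add: L ennreal_plus ennreal_mult sum_ennreal)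
    then have "ennreal (2 * (\<Sum>k<n. L k) + d) \<le> ennreal (\<rho> * d)" using n(3) by metis
    then have "2 * (\<Sum>k<n. L k) + d \<le> \<rho> * d"
      using \<open>1 \<le> d\<close> \<rho>(2) by (subst (asm) ennreal_le_iff) auto
    then show "\<exists>n. r n = i \<and> d \<le> L n \<and> (\<Sum>k<n. L k) \<le> (\<rho> - 1) / 2 * d"
      using n(1,2) L by (intro exI[of _ n]) (auto simp: field_simps ennreal_le_iff)
  qed (rule L(2))
  then have "phi (real m - 1) \<le> \<rho>" by (simp add: phi_nat[OF m])
  then show False using less \<rho> by (simp add: ennreal_leI leD)
qed

section \<open>The upper bound\<close>

definition sweep :: "nat \<Rightarrow> real \<Rightarrow> nat \<Rightarrow> real" where
  "sweep k D j = D * (\<Sum>i=1..j. base (real k) ^ i)"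

text \<open>Here \<open>k + 1\<close> is the number of remaining rays, \<open>U\<close> bounds the sum of the depths of all
  previous walks, and \<open>g j\<close> is the distance of the target on the ray that is visited after
  \<open>j\<close> further walks if these find nothing. The total depth \<open>U + sweep k D j\<close> of the walks
  preceding that visit is at most \<open>M\<close> times this distance.\<close>

definition adsub_bound :: "real \<Rightarrow> nat \<Rightarrow> real \<Rightarrow> real \<Rightarrow> (nat \<Rightarrow> ennreal) \<Rightarrow> bool" where
  "adsub_bound M k U D g \<longleftrightarrow> 1 \<le> D \<and> (real k + 1) * D \<le> U \<and> U + sweep k D k \<le> M * D \<and>
     (\<forall>j\<le>k. ennreal (U + sweep k D j) \<le> ennreal M * g j)"

lemma base_gt_1: "k \<ge> 1 \<Longrightarrow> 1 < base (real k)"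
  by (simp add: base_def)

lemma sweep_0 [simp]: "sweep k D 0 = 0"
  by (simp add: sweep_def)

lemma sweep_Suc: "sweep k D (Suc j) = D * base (real k) + sweep k (D * base (real k)) j"
proof -
  have "(\<Sum>i=1..Suc j. base (real k) ^ i) = base (real k) + (\<Sum>i=Suc 1..Suc j. base (real k) ^ i)"
    by (subst sum.atLeast_Suc_atMost) auto
  also have "(\<Sum>i=Suc 1..Suc j. base (real k) ^ i) = base (real k) * (\<Sum>i=1..j. base (real k) ^ i)"
    by (subst sum.shift_bounds_cl_Suc_ivl) (simp add: sum_distrib_left)
  finally show ?thesis by (simp add: sweep_def algebra_simps)
qed

lemma sweep_scale: "sweep k (D * c) j = c * sweep k D j"
  by (simp add: sweep_def)

lemma sweep_mono: "0 \<le> D \<Longrightarrow> i \<le> j \<Longrightarrow> sweep k D i \<le> sweep k D j"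
  unfolding sweep_def by (intro mult_left_mono sum_mono2) (auto simp: base_def)

lemma sweep_geometric:
  assumes "k \<ge> 1"
  shows "(real k + 1) * D + sweep k D j = (real k + 1) * D * base (real k) ^ j"
proof (induction j)
  case (Suc j)
  have "sweep k D (Suc j) = sweep k D j + D * base (real k) ^ Suc j"
    by (simp add: sweep_def algebra_simps)
  then have "(real k + 1) * D + sweep k D (Suc j)
      = (real k + 1) * D * base (real k) ^ j + D * base (real k) ^ Suc j"
    using Suc by simp
  also have "\<dots> = (real k + 1) * D * base (real k) ^ Suc j"
    using assms by (simp add: base_def field_simps)
  finally show ?case .
qed simp

lemma base_power_le:
  assumes "i \<le> k"
  shows "base (real k) ^ i \<le> base (real k + 1) ^ Suc i"
proof (cases "k = 0")
  case False
  define x where "x = real k"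
  have x: "x \<ge> 1" using False by (simp add: x_def)
  define q where "q = 1 + (- (1 / (x + 1)\<^sup>2))"
  have x1: "(x + 1)\<^sup>2 > 0" using x by simp
  have q: "base (x + 1) = q * base x" using x
    x1 unfolding base_def q_def by (simp add: divide_simps) (simp add: power2_eq_square algebra_simps)
  have "1 \<le> q ^ i * base (x + 1)"
  proof -
    have "base (x + 1) = (x + 2) / (x + 1)" using x by (simp add: base_def field_simps)
    then have one: "(x + 1) / (x + 2) * base (x + 1) = 1" using x by simp
    have "x * (x + 2) \<le> (x + 1)\<^sup>2" by (simp add: power2_eq_square algebra_simps)
    then have "x / (x + 1)\<^sup>2 \<le> 1 / (x + 2)"
      using x x1 by (simp add: pos_divide_le_eq pos_le_divide_eq)
    moreover have "(x + 1) / (x + 2) = 1 - 1 / (x + 2)" using x by (simp add: field_simps)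
    ultimately have "(x + 1) / (x + 2) \<le> 1 + real k * (- (1 / (x + 1)\<^sup>2))"
      by (simp add: x_def)
    also have "\<dots> \<le> 1 + real i * (- (1 / (x + 1)\<^sup>2))"
      using assms by (simp add: divide_right_mono)
    also have "\<dots> \<le> q ^ i"
      unfolding q_def by (rule Bernoulli_inequality) (use x in \<open>simp add: divide_le_eq_1 one_le_power\<close>)
    finally have "(x + 1) / (x + 2) * base (x + 1) \<le> q ^ i * base (x + 1)"
      using x by (intro mult_right_mono) (auto simp: base_def)
    then show ?thesis unfolding one .
  qed
  then have "base x ^ i * 1 \<le> base x ^ i * (q ^ i * base (x + 1))"
    using x by (intro mult_left_mono) (auto simp: base_def)
  then show ?thesis by (simp add: q power_mult_distrib x_def[symmetric] mult_ac)
qed (use assms in \<open>simp add: base_def\<close>)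

lemma adsub_bound_init:
  assumes k: "k \<ge> 1" and g: "\<And>j. j \<le> k \<Longrightarrow> 1 \<le> g j"
  shows "adsub_bound ((real k + 1) * base (real k) ^ k) k (real k + 1) 1 g"
proof -
  define M where "M = (real k + 1) * base (real k) ^ k"
  have b: "1 \<le> base (real k)" using base_gt_1[OF k] by simp
  have geo: "real k + 1 + sweep k 1 j = (real k + 1) * base (real k) ^ j" for j
    using sweep_geometric[OF k, of 1 j] by simp
  have "ennreal (real k + 1 + sweep k 1 j) \<le> ennreal M * g j" if "j \<le> k" for j
  proof -
    have "real k + 1 + sweep k 1 j \<le> M"
      unfolding geo M_def using that b by (intro mult_left_mono power_increasing) auto
    then have "ennreal (real k + 1 + sweep k 1 j) \<le> ennreal M * 1" by (simp add: ennreal_leI)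
    also have "\<dots> \<le> ennreal M * g j" using g[OF that] by (intro mult_left_mono) auto
    finally show ?thesis .
  qed
  then show ?thesis using geo[of k] by (simp add: adsub_bound_def M_def[symmetric])
qed

lemma adsub_bound_miss:
  assumes inv: "adsub_bound M k U D g" and k: "k \<ge> 1"
    and far: "ennreal (D * base (real k)) \<le> g 0"
  shows "adsub_bound M k (U + D * base (real k)) (D * base (real k))
    (\<lambda>j. g (if j < k then Suc j else 0))"
proof -
  let ?b = "base (real k)"
  have b: "1 < ?b" by (rule base_gt_1[OF k])
  have D: "1 \<le> D" and U: "(real k + 1) * D \<le> U" and last: "U + sweep k D k \<le> M * D"
    and g: "\<And>j. j \<le> k \<Longrightarrow> ennreal (U + sweep k D j) \<le> ennreal M * g j"
    using inv by (auto simp: adsub_bound_def)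
  have U': "(real k + 1) * (D * ?b) \<le> U + D * ?b"
  proof -
    have "(real k + 1) * (D * ?b) = (real k + 1) * D + D * ?b"
      using k by (simp add: base_def field_simps)
    then show ?thesis using U by simp
  qed
  have last': "U + D * ?b + sweep k (D * ?b) k \<le> M * (D * ?b)"
  proof -
    have "(real k + 1) * D * (?b - 1) \<le> U * (?b - 1)" using U b by (intro mult_right_mono) auto
    moreover have "(real k + 1) * D * (?b - 1) = D * ?b" using k by (simp add: base_def field_simps)
    ultimately have "U + D * ?b \<le> ?b * U" by (simp add: algebra_simps)
    moreover have "?b * (U + sweep k D k) \<le> ?b * (M * D)" using last b by (intro mult_left_mono) auto
    ultimately show ?thesis by (simp add: sweep_scale algebra_simps)
  qed
  have "ennreal (U + D * ?b + sweep k (D * ?b) j) \<le> ennreal M * g (if j < k then Suc j else 0)"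
    if "j \<le> k" for j
  proof (cases "j < k")
    case True
    then show ?thesis using g[of "Suc j"] by (simp add: sweep_Suc add.assoc)
  next
    case False
    then have j: "j = k" using that by simp
    have s: "0 \<le> sweep k (D * ?b) k"
      using sweep_mono[of "D * ?b" 0 k k] D b by simp
    have "0 < M * (D * ?b)" using last' s U D b
      by (smt (verit) mult_nonneg_nonneg mult_pos_pos of_nat_0_le_iff)
    moreover have "0 < D * ?b" using D b by simp
    ultimately have M: "0 \<le> M" by (metis less_imp_le zero_less_mult_pos2)
    have "ennreal (U + D * ?b + sweep k (D * ?b) j) \<le> ennreal (M * (D * ?b))"
      unfolding j by (rule ennreal_leI[OF last'])
    also have "\<dots> = ennreal M * ennreal (D * ?b)" using M D b by (simp add: ennreal_mult)
    also have "\<dots> \<le> ennreal M * g 0" by (intro mult_left_mono far) simp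
    finally show ?thesis using False by simp
  qed
  moreover have "1 \<le> D * ?b" using D b by (smt (verit) mult_le_cancel_left1)
  ultimately show ?thesis using U' last' by (simp add: adsub_bound_def)
qed

lemma adsub_bound_hit:
  assumes inv: "adsub_bound M (Suc k) U D g" and d: "0 \<le> d" "d \<le> D * base (real (Suc k))"
  shows "adsub_bound M k (U + d) D (\<lambda>j. g (Suc j))"
proof -
  have D: "1 \<le> D" and U: "(real (Suc k) + 1) * D \<le> U"
    and last: "U + sweep (Suc k) D (Suc k) \<le> M * D"
    and g: "\<And>j. j \<le> Suc k \<Longrightarrow> ennreal (U + sweep (Suc k) D j) \<le> ennreal M * g j"
    using inv by (auto simp: adsub_bound_def)
  have le: "U + d + sweep k D j \<le> U + sweep (Suc k) D (Suc j)" if "j \<le> k" for j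
  proof -
    have "sweep k D j \<le> D * (\<Sum>i=1..j. base (real (Suc k)) ^ Suc i)"
      unfolding sweep_def using D that base_power_le[of _ k]
      by (intro mult_left_mono sum_mono) (auto simp: add.commute simp del: power_Suc)
    also have "\<dots> = sweep (Suc k) (D * base (real (Suc k))) j"
      by (simp add: sweep_def sum_distrib_left mult.assoc)
    finally show ?thesis using d(2) by (simp only: sweep_Suc)
  qed
  have "(real k + 1) * D \<le> U + d" using U D d by (simp add: algebra_simps)
  moreover have "U + d + sweep k D k \<le> M * D" using le[of k] last by simp
  moreover have "ennreal (U + d + sweep k D j) \<le> ennreal M * g (Suc j)" if "j \<le> k" for j
    using ennreal_leI[OF le[OF that]] g[of "Suc j"] that by (meson Suc_le_mono order_trans)
  ultimately show ?thesis using D by (simp add: adsub_bound_def)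
qed

lemma tour_length_ge:
  assumes "finite S" "x \<in> S"
  shows "dist_of I x \<le> tour_length I S"
proof -
  define T where "T = (\<Sum>i\<in>S. dist_of I i)"
  have le: "dist_of I i \<le> T" if "i \<in> S" for i
    unfolding T_def using assms that by (intro member_le_sum) auto
  have sup: "(SUP i\<in>S. dist_of I i) \<le> T" by (rule SUP_least) (rule le)
  show ?thesis
  proof (cases "T = \<infinity>")
    case True
    then show ?thesis by (simp add: tour_length_def T_def[symmetric] ennreal_mult_top)
  next
    case False
    have "dist_of I x \<le> T + T - T" using le[OF assms(2)] False by simp
    also have "\<dots> \<le> T + T - (SUP i\<in>S. dist_of I i)" by (intro ennreal_minus_mono sup order_refl)
    finally show ?thesis by (simp add: tour_length_def T_def[symmetric] mult_2)
  qed
qed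

lemma rotate_remove_hd:
  assumes "r < length rs" "length rs \<ge> 2"
  shows "rotate (r mod (length rs - 1)) (take r rs @ drop (Suc r) rs) = tl (rotate r rs)"
proof -
  have "rotate (r mod (length rs - 1)) (take r rs @ drop (Suc r) rs)
      = rotate (length (take r rs)) (take r rs @ drop (Suc r) rs)"
    using assms by (subst (2) rotate_conv_mod) (simp add: min_def)
  also have "\<dots> = drop (Suc r) rs @ take r rs" by (rule rotate_append)
  also have "\<dots> = tl (rotate r rs)"
    using assms by (simp add: rotate_drop_take tl_append drop_Suc[symmetric] tl_drop split: list.split)
      (metis Cons_nth_drop_Suc list.sel(3))
  finally show ?thesis .
qed

lemma AdSub_walk:
  assumes "adsub_state m h = (f, r, D, rs)"
  shows "AdSub m h = (rs ! r, if f = m then \<infinity> else ennreal (D * base (real m - real f)))"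
  using assms by (simp add: AdSub_def)

lemma adsub_bound_history:
  fixes m :: nat and I :: search_instance
  defines "h \<equiv> history (AdSub m) I"
  assumes m: "m \<ge> 2" and I: "I \<in> search_instances m"
    and x: "x < m" "dist_of I x \<noteq> \<infinity>" "x \<notin> emptied (AdSub m) (h n)"
    and st: "adsub_state m (h n) = (f, r, D, rs)"
  shows "\<exists>U. real n \<le> U \<and> (\<Sum>k<n. reach (AdSub m) I k) \<le> ennreal U \<and>
    adsub_bound (real m * base (real m - 1) ^ (m - 1)) (m - f) U D (\<lambda>j. dist_of I (rotate r rs ! j))"
  using x(3) st
proof (induction n arbitrary: f r D rs)
  case 0
  have st: "f = 1" "r = 0" "D = 1" "rs = [0..<m]" using 0 by (auto simp: h_def)
  have k: "real (m - 1) = real m - 1" "real m - 1 + 1 = real m" using m by auto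
  have "adsub_bound ((real (m - 1) + 1) * base (real (m - 1)) ^ (m - 1)) (m - 1) (real (m - 1) + 1) 1
      (\<lambda>j. dist_of I (rotate r rs ! j))"
    by (rule adsub_bound_init) (use m I st in \<open>auto simp: search_instances_def\<close>)
  then have "adsub_bound (real m * base (real m - 1) ^ (m - 1)) (m - f) (real m) D
      (\<lambda>j. dist_of I (rotate r rs ! j))"
    unfolding k st .
  then show ?case by (intro exI[of _ "real m"]) simp
next
  case (Suc n)
  define M where "M = real m * base (real m - 1) ^ (m - 1)"
  obtain f0 r0 D0 rs0 where st0: "adsub_state m (h n) = (f0, r0, D0, rs0)"
    by (cases "adsub_state m (h n)") auto
  define y l where "y = rs0 ! r0"
    and "l = (if f0 = m then \<infinity> else ennreal (D0 * base (real m - real f0)))"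
  have walk: "AdSub m (h n) = (y, l)" using AdSub_walk[OF st0] by (simp add: y_def l_def)
  have hSuc: "h (Suc n) = observe I y l # h n" using walk by (simp add: h_def)
  have x0: "x \<notin> emptied (AdSub m) (h n)" and xy: "observe I y l \<noteq> None \<Longrightarrow> x \<noteq> y"
    using Suc.prems(1) walk unfolding hSuc by (cases "observe I y l"; simp)+
  from Suc.IH[OF x0 st0] obtain U where U: "real n \<le> U"
    "(\<Sum>k<n. reach (AdSub m) I k) \<le> ennreal U"
    "adsub_bound M (m - f0) U D0 (\<lambda>j. dist_of I (rotate r0 rs0 ! j))"
    unfolding M_def by blast
  have D0: "1 \<le> D0" using U(3) by (simp add: adsub_bound_def)
  have inv: "distinct rs0 \<and> set rs0 = {..<m} - emptied (AdSub m) (h n) \<and>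
         (f0 \<le> m \<longrightarrow> length rs0 = m - f0 + 1 \<and> r0 < length rs0) \<and> (f0 > m \<longrightarrow> rs0 = [])"
    by (rule adsub_state_invariant[OF st0]) (use m in simp)
  have xrs: "x \<in> set rs0" using inv x(1) x0 by simp
  then have f0: "f0 \<le> m" using inv by (metis empty_iff empty_set not_le)
  then have len: "length rs0 = m - f0 + 1" and r0: "r0 < length rs0" using inv by auto
  have y: "y < m" using r0 inv unfolding y_def by (metis DiffD1 lessThan_iff nth_mem)
  have reach: "reach (AdSub m) I n = min (dist_of I y) l"
    using walk by (simp add: reach_def h_def)
  have km: "real m - real f0 = real (m - f0)" using f0 by simp
  have q0: "rotate r0 rs0 ! 0 = y"
    using r0 by (subst nth_rotate) (auto simp: y_def)
  have f0m: "f0 < m"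
  proof (rule ccontr)
    assume "\<not> f0 < m"
    then have "f0 = m" using f0 by simp
    then have "length rs0 = 1" using len by simp
    then obtain z where "rs0 = [z]" by (auto simp: length_Suc_conv)
    then have "x = y" using xrs r0 by (simp add: y_def)
    moreover have "observe I y l \<noteq> None"
      using x(2) \<open>f0 = m\<close> \<open>x = y\<close> by (simp add: observe_def l_def)
    ultimately show False using xy by simp
  qed
  define b where "b = base (real (m - f0))"
  have b: "1 < b" unfolding b_def using f0m by (intro base_gt_1) simp
  have l: "l = ennreal (D0 * b)" using f0m km by (simp add: l_def b_def)
  show ?case
  proof (cases "observe I y l")
    case None
    have far: "l \<le> dist_of I y" using None by (auto simp: observe_def l split: if_splits)
    have "f = f0" "r = (r0 + 1) mod length rs0" "D = D0 * b" "rs = rs0"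
      using Suc.prems(2) len unfolding hSuc None by (auto simp: st0 b_def km)
    note st1 = this
    have rot: "rotate r rs ! j = rotate r0 rs0 ! (if j < m - f0 then Suc j else 0)"
      if "j \<le> m - f0" for j
    proof -
      have j: "j < length rs0" using that len by simp
      have "rotate r rs ! j = rs0 ! ((r0 + 1 + j) mod length rs0)"
        using j by (simp add: st1 nth_rotate mod_add_left_eq)
      moreover have "(r0 + 1 + j) mod length rs0 = (r0 + 0) mod length rs0" if "\<not> j < m - f0"
      proof -
        have "r0 + 1 + j = r0 + length rs0" using that j len by simp
        then show ?thesis by (simp only: mod_add_self2 add_0_right)
      qed
      ultimately show ?thesis using j len by (auto simp: nth_rotate)
    qed
    have "adsub_bound M (m - f0) (U + D0 * b) (D0 * b)
        (\<lambda>j. dist_of I (rotate r0 rs0 ! (if j < m - f0 then Suc j else 0)))"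
      unfolding b_def by (rule adsub_bound_miss[OF U(3)])
        (use f0m far in \<open>simp_all add: q0 l b_def\<close>)
    then have "adsub_bound M (m - f) (U + D0 * b) D (\<lambda>j. dist_of I (rotate r rs ! j))"
      using rot by (simp add: adsub_bound_def st1 del: rotate_rotate)
    moreover have "1 \<le> D0 * b" using D0 b by (smt (verit) mult_le_cancel_left1)
    moreover from this have "(\<Sum>k<Suc n. reach (AdSub m) I k) \<le> ennreal (U + D0 * b)"
      using U(1,2) far by (simp add: reach l min_def add_mono)
    ultimately show ?thesis using U(1) unfolding M_def by (intro exI[of _ "U + D0 * b"]) auto
  next
    case (Some v)
    then have near: "dist_of I y \<le> l" by (auto simp: observe_def split: if_splits)
    define d where "d = enn2real (dist_of I y)"
    have d: "dist_of I y = ennreal d" "0 \<le> d"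
      using near by (auto simp: d_def l ennreal_enn2real_if top_unique)
    have "1 \<le> dist_of I y" using I y by (simp add: search_instances_def)
    then have d1: "1 \<le> d" using d by (metis ennreal_1 ennreal_le_iff)
    have dle: "d \<le> D0 * b" using near d D0 b by (simp add: l ennreal_le_iff)
    have st1: "f = f0 + 1" "r = r0 mod (length rs0 - 1)" "D = D0"
      "rs = take r0 rs0 @ drop (Suc r0) rs0"
      using Suc.prems(2) len f0m unfolding hSuc Some by (auto simp: st0 Let_def Suc_diff_Suc)
    have k: "m - f0 = Suc (m - f)" using f0m st1 by simp
    have rot: "rotate r rs = tl (rotate r0 rs0)"
      unfolding st1 using r0 len f0m by (intro rotate_remove_hd) auto
    have "adsub_bound M (m - f) (U + d) D0 (\<lambda>j. dist_of I (rotate r0 rs0 ! Suc j))"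
      using U(3) d(2) dle unfolding b_def k by (rule adsub_bound_hit)
    then have "adsub_bound M (m - f) (U + d) D (\<lambda>j. dist_of I (rotate r rs ! j))"
      unfolding rot using len k by (simp add: adsub_bound_def st1 nth_tl)
    moreover have "(\<Sum>k<Suc n. reach (AdSub m) I k) \<le> ennreal (U + d)"
      using U(1,2) near d by (simp add: reach min_def add_mono)
    ultimately show ?thesis using U(1) d1 unfolding M_def by (intro exI[of _ "U + d"]) auto
  qed
qed

lemma AdSub_next_cost:
  fixes m :: nat and I :: search_instance
  defines "\<rho> \<equiv> AdSub m" and "M \<equiv> real m * base (real m - 1) ^ (m - 1)"
  assumes m: "m \<ge> 2" and I: "I \<in> search_instances m"
    and x: "x < m" "dist_of I x \<noteq> \<infinity>" "x \<notin> emptied \<rho> (history \<rho> I n)"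
  shows "of_nat n \<le> ennreal M * dist_of I x"
    and "(\<Sum>k<n. 2 * reach \<rho> I k) + reach \<rho> I n \<le> ennreal (1 + 2 * M) * dist_of I x"
proof -
  obtain f r D rs where st: "adsub_state m (history \<rho> I n) = (f, r, D, rs)"
    by (cases "adsub_state m (history \<rho> I n)") auto
  obtain U where U: "real n \<le> U" "(\<Sum>k<n. reach \<rho> I k) \<le> ennreal U"
    "adsub_bound M (m - f) U D (\<lambda>j. dist_of I (rotate r rs ! j))"
    using adsub_bound_history[OF m I x[unfolded \<rho>_def] st[unfolded \<rho>_def]]
    unfolding \<rho>_def M_def by blast
  have inv: "distinct rs \<and> set rs = {..<m} - emptied \<rho> (history \<rho> I n) \<and>
         (f \<le> m \<longrightarrow> length rs = m - f + 1 \<and> r < length rs) \<and> (f > m \<longrightarrow> rs = [])"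
    unfolding \<rho>_def by (rule adsub_state_invariant[OF st[unfolded \<rho>_def]]) (use m in simp)
  have xrs: "x \<in> set rs" using inv x by simp
  then have f: "f \<le> m" using inv by (metis empty_iff empty_set not_le)
  then have len: "length rs = m - f + 1" and r: "r < length rs" using inv by auto
  have D: "1 \<le> D" using U(3) by (simp add: adsub_bound_def)
  obtain j where j: "j < length rs" "rotate r rs ! j = x"
    using xrs by (metis in_set_conv_nth length_rotate set_rotate)
  define d where "d = enn2real (dist_of I x)"
  have d: "dist_of I x = ennreal d" "0 \<le> d" using x(2) by (auto simp: d_def ennreal_enn2real_if)
  have M: "0 \<le> M" unfolding M_def using m by (simp add: base_def)
  have "ennreal (U + sweep (m - f) D j) \<le> ennreal M * dist_of I x"
    using U(3) j len by (auto simp: adsub_bound_def)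
  then have le: "U + sweep (m - f) D j \<le> M * d"
    using M d by (simp add: ennreal_mult[symmetric] ennreal_le_iff)
  have "0 \<le> sweep (m - f) D j" using sweep_mono[of D 0 j "m - f"] D by simp
  then have Ule: "U \<le> M * d" using le by simp
  have "of_nat n = ennreal (real n)" by (simp add: ennreal_of_nat_eq_real_of_nat)
  also have "\<dots> \<le> ennreal (M * d)" using U(1) Ule by (intro ennreal_leI) simp
  finally show "of_nat n \<le> ennreal M * dist_of I x" using M d by (simp add: ennreal_mult)
  have walk: "reach \<rho> I n = min (dist_of I (rs ! r))
      (if f = m then \<infinity> else ennreal (D * base (real m - real f)))"
    unfolding \<rho>_def reach_def by (simp add: AdSub_walk[OF st[unfolded \<rho>_def]])
  obtain e where e: "reach \<rho> I n \<le> ennreal e" "0 \<le> e" "2 * U + e \<le> (1 + 2 * M) * d"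
  proof (cases j)
    case 0
    then have "rs ! r = x" using j r by (simp add: nth_rotate)
    then show ?thesis using that[of d] walk d Ule by (simp add: algebra_simps)
  next
    case (Suc i)
    then have fm: "f < m" using j(1) len f by (cases "f = m") auto
    define b where "b = base (real (m - f))"
    have b: "1 < b" unfolding b_def using fm by (intro base_gt_1) simp
    have "0 \<le> sweep (m - f) (D * b) i" using sweep_mono[of "D * b" 0 i "m - f"] D b by simp
    then have "U + D * b \<le> M * d" using le by (simp add: Suc sweep_Suc b_def)
    moreover have "reach \<rho> I n \<le> ennreal (D * b)" using walk fm by (simp add: b_def)
    moreover have "0 \<le> D * b" using D b by simp
    ultimately show ?thesis using that[of "D * b"] d(2) by (simp add: algebra_simps)
  qed
  have "(\<Sum>k<n. 2 * reach \<rho> I k) + reach \<rho> I n \<le> 2 * ennreal U + ennreal e"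
    unfolding sum_distrib_left[symmetric] using U(2) e(1) by (intro add_mono mult_left_mono) auto
  also have "\<dots> = ennreal (2 * U + e)" using U(1) e(2) by (simp add: ennreal_plus ennreal_mult)
  also have "\<dots> \<le> ennreal ((1 + 2 * M) * d)" by (rule ennreal_leI[OF e(3)])
  also have "\<dots> = ennreal (1 + 2 * M) * dist_of I x" using d M by (simp add: ennreal_mult)
  finally show "(\<Sum>k<n. 2 * reach \<rho> I k) + reach \<rho> I n \<le> ennreal (1 + 2 * M) * dist_of I x" .
qed

text \<open>Only true while the search is unfinished: once every ray is emptied, the strategy may
  name rays beyond \<open>m\<close>.\<close>

lemma emptied_subset_rays:
  assumes "search_strategy m \<sigma>" "I \<in> search_instances m" "\<And>k. k < n \<Longrightarrow> \<not> satisfied \<sigma> I k"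
  shows "emptied \<sigma> (history \<sigma> I n) \<subseteq> {..<m}"
  using assms(3)
proof (induction n)
  case (Suc n)
  let ?h = "history \<sigma> I n"
  have IH: "emptied \<sigma> ?h \<subseteq> {..<m}" using Suc by simp
  have "{..<m} - emptied \<sigma> ?h \<noteq> {}"
  proof
    assume "{..<m} - emptied \<sigma> ?h = {}"
    then have "emptied \<sigma> ?h = {..<m}" using IH by blast
    then have "satisfied \<sigma> I n"
      using assms(2) by (simp add: satisfied_def total_weight_def search_instances_def)
    then show False using Suc.prems[of n] by simp
  qed
  then have "fst (\<sigma> ?h) < m" using assms(1) by (auto simp: search_strategy_def)
  then show ?case using IH
    by (cases "observe I (fst (\<sigma> ?h)) (snd (\<sigma> ?h))") (auto simp: Let_def case_prod_beta)
qed simp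

lemma cost_AdSch_le:
  assumes m: "m \<ge> 2" and I: "I \<in> search_instances m"
  shows "cost (AdSch m) I \<le> ennreal (phi (real m - 1)) * opt m I"
proof (cases "opt m I = \<infinity>")
  case True
  have "phi (real m - 1) > 0"
    using m by (simp add: phi_nat[OF m] base_def add_pos_nonneg)
  then show ?thesis using True by (simp add: ennreal_mult_top)
next
  case False
  define \<rho> M where "\<rho> = AdSub m" and "M = real m * base (real m - 1) ^ (m - 1)"
  have strat: "search_strategy m \<rho>"
    using AdSch_search_strategy[of m] m by (simp add: \<rho>_def AdSch_def)
  let ?T = "{tour_length I S | S. S \<subseteq> {..<m} \<and> required I \<le> total_weight I S}"
  have "tour_length I {..<m} \<in> ?T"
    using I by (auto simp: search_instances_def total_weight_def)
  then have "opt m I \<in> ?T" unfolding opt_def by (intro Min_in finite_tours) auto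
  then obtain S where S: "S \<subseteq> {..<m}" "required I \<le> total_weight I S" "opt m I = tour_length I S"
    by auto
  have dist_le: "dist_of I x \<le> opt m I" if "x \<in> S" for x
    unfolding S(3) using S(1) that by (intro tour_length_ge) (auto intro: finite_subset)
  have unfound: "\<exists>x\<in>S. x \<notin> emptied \<rho> (history \<rho> I n)" if "\<And>k. k \<le> n \<Longrightarrow> \<not> satisfied \<rho> I k" for n
  proof (rule ccontr)
    assume "\<not> ?thesis"
    then have "S \<subseteq> emptied \<rho> (history \<rho> I n)" by blast
    moreover have "emptied \<rho> (history \<rho> I n) \<subseteq> {..<m}"
      using that by (intro emptied_subset_rays strat I) auto
    ultimately have "total_weight I S \<le> total_weight I (emptied \<rho> (history \<rho> I n))"
      unfolding total_weight_def using I
      by (intro sum_mono2 finite_emptied) (auto simp: search_instances_def)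
    then have "satisfied \<rho> I n" using S(2) by (simp add: satisfied_def)
    then show False using that by simp
  qed
  have next_cost: "of_nat n \<le> ennreal M * opt m I \<and>
      (\<Sum>k<n. 2 * reach \<rho> I k) + reach \<rho> I n \<le> ennreal (1 + 2 * M) * opt m I"
    if unsat: "\<And>k. k \<le> n \<Longrightarrow> \<not> satisfied \<rho> I k" for n
  proof -
    obtain x where x: "x \<in> S" "x \<notin> emptied \<rho> (history \<rho> I n)" using unfound[OF unsat] by auto
    have "x < m" "dist_of I x \<noteq> \<infinity>" using x S(1) dist_le[of x] False by (auto simp: top_unique)
    from AdSub_next_cost[OF m I this x(2)[unfolded \<rho>_def], folded \<rho>_def M_def]
    show ?thesis using dist_le[OF x(1)] by (meson mult_left_mono order_trans zero_le)
  qed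
  have ex: "\<exists>n. satisfied \<rho> I n"
  proof (rule ccontr)
    assume "\<not> ?thesis"
    then have "of_nat n \<le> ennreal M * opt m I" for n :: nat using next_cost by blast
    moreover have "ennreal M * opt m I < top"
      using False by (simp add: ennreal_mult_less_top less_top)
    ultimately show False using ennreal_Ex_less_of_nat by (metis infinity_ennreal_def not_le)
  qed
  define N where "N = (LEAST n. satisfied \<rho> I n)"
  have unsat: "\<not> satisfied \<rho> I k" if "k < N" for k using not_less_Least that unfolding N_def by blast
  have "cost \<rho> I \<le> ennreal (1 + 2 * M) * opt m I"
  proof (cases N)
    case 0
    then show ?thesis using ex by (simp add: cost_def N_def[symmetric])
  next
    case (Suc n)
    then show ?thesis using ex next_cost[of n] unsat by (simp add: cost_def N_def[symmetric])
  qed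
  then show ?thesis by (simp add: phi_nat[OF m] M_def \<rho>_def AdSch_def)
qed

theorem theorem1:
  fixes m :: nat
  assumes "m \<ge> 2"
  shows "(\<forall>I\<in>search_instances m. cost (AdSch m) I \<le> ennreal (phi (real m - 1)) * opt m I)
    \<and> competitive_ratio m (AdSch m) = ennreal (phi (real m - 1))
    \<and> (\<forall>\<sigma>. search_strategy m \<sigma> \<longrightarrow> competitive_ratio m \<sigma> \<ge> ennreal (phi (real m - 1)))"
proof (intro conjI ballI allI impI)
  show "cost (AdSch m) I \<le> ennreal (phi (real m - 1)) * opt m I" if "I \<in> search_instances m" for I
    by (rule cost_AdSch_le[OF assms that])
  show "competitive_ratio m (AdSch m) = ennreal (phi (real m - 1))"
  proof (rule antisym)
    show "competitive_ratio m (AdSch m) \<le> ennreal (phi (real m - 1))"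
      unfolding competitive_ratio_def
      by (intro SUP_least divide_le_ennreal_if_le_times cost_AdSch_le assms)
  qed (rule competitive_ratio_ge[OF assms])
  show "ennreal (phi (real m - 1)) \<le> competitive_ratio m \<sigma>" if "search_strategy m \<sigma>" for \<sigma>
    by (rule competitive_ratio_ge[OF assms])
qed

end
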